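(* Let $\kappa$ be a cardinal such that there is an uncountable closed and discrete subset $D$ of $\mathbb{R}^\kappa$ that is $C$-embedded in $\mathbb{R}^\kappa$. Then, for any such $D$, the product $D\times D$ is not $C^*$-embedded in $\mathbb{R}^\kappa\times\mathbb{R}^\kappa$.
   Context: $\mathbb{R}^\kappa$ carries the product topology. A subspace $A$ of a space $X$ is $C$-embedded in $X$ if every continuous function from $A$ to $\mathbb{R}$ admits a continuous extension to $X$; it is $C^*$-embedded in $X$ if every bounded continuous function from $A$ to $\mathbb{R}$ admits a continuous extension to $X$. *)

theory Defs
  imports "HOL-Analysis.Analysis"
begin

definition C_embedded_in :: "'a topology \<Rightarrow> 'a set \<Rightarrow> bool" where
  "C_embedded_in X A \<longleftrightarrow>
     A \<subseteq> topspace X \<and>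
     (\<forall>f. continuous_map (subtopology X A) euclideanreal f \<longrightarrow>
          (\<exists>g. continuous_map X euclideanreal g \<and> (\<forall>x\<in>A. g x = f x)))"

definition C_star_embedded_in :: "'a topology \<Rightarrow> 'a set \<Rightarrow> bool" where
  "C_star_embedded_in X A \<longleftrightarrow>
     A \<subseteq> topspace X \<and>
     (\<forall>f. continuous_map (subtopology X A) euclideanreal f \<and> bounded (f ` A) \<longrightarrow>
          (\<exists>g. continuous_map X euclideanreal g \<and> (\<forall>x\<in>A. g x = f x)))"

end

theory Submission
  imports Defs
begin

text \<open>
  The obstruction is the indicator function of the diagonal of \<open>D \<times> D\<close>.  It is bounded, and it is
  continuous because \<open>D \<times> D\<close> is discrete; a continuous extension \<open>g\<close> cannot exist when \<open>D\<close> is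
  uncountable.  The underlying reason is that a continuous real function on a power of the line
  depends on countably many coordinates only: \<open>g\<close> would factor through a second countable space,
  in which the image of \<open>D\<close> would be an uncountable discrete set.

  Full factorisation is more than is required, and the proof below uses a closing-off argument
  instead.  Basic open boxes with rational sides are coded by finite lists of constraints
  (coordinate, lower bound, upper bound).  There is a countable set \<open>S\<close> of coordinates such that
  every box \<open>A\<close> with constraints in \<open>S\<close> whose square meets \<open>{g < 1/2}\<close> contains nonempty boxes \<open>P\<close>, \<open>Q\<close>,
  also with constraints in \<open>S\<close>, such that \<open>P \<times> Q\<close> lies inside \<open>{g < 1/2}\<close>
  (lemma \<open>countable_closing_off\<close>).  Each \<open>x \<in> D\<close> has a box \<open>W x\<close> with \<open>W x \<times> W x\<close> inside
  \<open>{g > 1/2}\<close>.  Only countably many boxes have all constraints in \<open>S\<close>, so if \<open>D\<close> is uncountable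
  then two distinct points \<open>x\<close>, \<open>y\<close> yield the same box \<open>A\<close> after the constraints outside \<open>S\<close> are
  dropped.  As \<open>(x, y) \<in> A \<times> A\<close> and \<open>g (x, y) = 0\<close>, boxes \<open>P\<close>, \<open>Q\<close> as above exist.
  Points of \<open>P\<close> and \<open>Q\<close>, overwritten by \<open>x\<close> outside \<open>S\<close>, remain in \<open>P\<close> and \<open>Q\<close>
  and enter \<open>W x\<close>, so \<open>g\<close> is both below and above \<open>1/2\<close> there.
\<close>

definition rat_box :: "'k set \<Rightarrow> ('k \<times> rat \<times> rat) list \<Rightarrow> ('k \<Rightarrow> real) set" where
  "rat_box K c = {x \<in> (\<Pi>\<^sub>E k\<in>K. UNIV). \<forall>k q r. (k, q, r) \<in> set c \<longrightarrow> of_rat q < x k \<and> x k < of_rat r}"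

lemma in_rat_boxI:
  assumes "x \<in> (\<Pi>\<^sub>E k\<in>K. UNIV)"
    and "\<And>k q r. (k, q, r) \<in> set c \<Longrightarrow> of_rat q < x k \<and> x k < of_rat r"
  shows "x \<in> rat_box K c"
  using assms by (auto simp: rat_box_def)

lemma in_rat_boxD:
  assumes "x \<in> rat_box K c" "(k, q, r) \<in> set c"
  shows "of_rat q < x k" "x k < of_rat r"
  using assms by (auto simp: rat_box_def)

lemma rat_box_antimono: "set c \<subseteq> set d \<Longrightarrow> rat_box K d \<subseteq> rat_box K c"
  by (auto simp: rat_box_def)

lemma rat_box_append: "rat_box K (c @ d) = rat_box K c \<inter> rat_box K d"
  by (auto simp: rat_box_def)

lemma in_rat_box_PiE: "x \<in> rat_box K c \<Longrightarrow> x \<in> (\<Pi>\<^sub>E k\<in>K. UNIV)"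
  by (simp add: rat_box_def)

lemma rat_box_neighbourhood:
  assumes "openin (powertop_real K) U" "x \<in> U"
  obtains c where "x \<in> rat_box K c" "rat_box K c \<subseteq> U"
proof -
  obtain V where fin: "finite {k \<in> K. V k \<noteq> UNIV}" and op: "\<And>k. k \<in> K \<Longrightarrow> open (V k)"
    and xV: "x \<in> (\<Pi>\<^sub>E k\<in>K. V k)" and VU: "(\<Pi>\<^sub>E k\<in>K. V k) \<subseteq> U"
    using assms by (force simp: openin_product_topology_alt)
  define F where "F = {k \<in> K. V k \<noteq> UNIV}"
  have "\<exists>q r. of_rat q < x k \<and> x k < of_rat r \<and> {of_rat q<..<of_rat r} \<subseteq> V k" if "k \<in> F" for k
  proof -
    have "open (V k)" "x k \<in> V k" using that op xV by (auto simp: F_def)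
    then obtain e where e: "e > 0" "ball (x k) e \<subseteq> V k"
      by (meson openE)
    obtain q r where "x k - e < of_rat q" "of_rat q < x k" "x k < of_rat r" "of_rat r < x k + e"
      using of_rat_dense[of "x k - e" "x k"] of_rat_dense[of "x k" "x k + e"] e by auto
    moreover from this have "{of_rat q<..<of_rat r} \<subseteq> ball (x k) e"
      by (auto simp: dist_real_def)
    ultimately show ?thesis using e by blast
  qed
  then obtain q r where qr: "\<And>k. k \<in> F \<Longrightarrow> of_rat (q k) < x k \<and> x k < of_rat (r k)
      \<and> {of_rat (q k)<..<of_rat (r k)} \<subseteq> V k"
    by metis
  obtain ks where ks: "set ks = F"
    using fin finite_list unfolding F_def by blast
  define c where "c = map (\<lambda>k. (k, q k, r k)) ks"
  have "x \<in> rat_box K c"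
    using xV qr ks by (intro in_rat_boxI) (auto simp: c_def PiE_iff)
  moreover have "rat_box K c \<subseteq> U"
  proof
    fix z assume z: "z \<in> rat_box K c"
    have "z k \<in> V k" if "k \<in> K" for k
    proof (cases "k \<in> F")
      case True
      then have "(k, q k, r k) \<in> set c" by (simp add: c_def ks)
      from in_rat_boxD[OF z this] show ?thesis using qr[OF True] by auto
    next
      case False
      with that show ?thesis by (simp add: F_def)
    qed
    then have "z \<in> (\<Pi>\<^sub>E k\<in>K. V k)"
      using in_rat_box_PiE[OF z] by (auto simp: PiE_iff)
    then show "z \<in> U" using VU by blast
  qed
  ultimately show thesis by (rule that)
qed

lemma rat_box_neighbourhood_prod:
  assumes "openin (prod_topology (powertop_real K) (powertop_real K)) U" "(x, y) \<in> U"
  obtains c d where "x \<in> rat_box K c" "y \<in> rat_box K d" "rat_box K c \<times> rat_box K d \<subseteq> U"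
proof -
  obtain A B where A: "openin (powertop_real K) A" "x \<in> A"
    and B: "openin (powertop_real K) B" "y \<in> B" and AB: "A \<times> B \<subseteq> U"
    using openin_prod_topology_alt[THEN iffD1, OF assms(1), rule_format, OF assms(2)] by auto
  obtain c where c: "x \<in> rat_box K c" "rat_box K c \<subseteq> A"
    using rat_box_neighbourhood[OF A] .
  obtain d where d: "y \<in> rat_box K d" "rat_box K d \<subseteq> B"
    using rat_box_neighbourhood[OF B] .
  show thesis
    using c d AB by (intro that[of c d]) auto
qed

text \<open>
  A list mentions finitely many coordinates, so it is already supported by a finite stage of the
  iteration and its value is absorbed at the next one; hence \<open>\<omega>\<close> stages are enough.
\<close>

lemma countable_closing_off:
  fixes F :: "('k \<times> 'b::countable) list \<Rightarrow> 'k set"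
  assumes "\<And>c. countable (F c)"
  obtains S where "countable S" "\<And>c. fst ` set c \<subseteq> S \<Longrightarrow> F c \<subseteq> S"
proof -
  define step where "step T = T \<union> (\<Union>c \<in> lists (T \<times> UNIV). F c)" for T
  define stage where "stage n = (step ^^ n) {}" for n
  have Suc: "stage (Suc n) = step (stage n)" for n
    by (simp add: stage_def)
  have cnt: "countable (stage n)" for n
  proof (induction n)
    case 0
    show ?case by (simp add: stage_def)
  next
    case (Suc n)
    then show ?case
      unfolding \<open>stage (Suc n) = step (stage n)\<close> step_def
      by (intro countable_Un countable_UN countable_lists countable_SIGMA assms) auto
  qed
  have mono: "stage m \<subseteq> stage n" if "m \<le> n" for m n
    using that by (rule lift_Suc_mono_le[rotated]) (auto simp: Suc step_def)
  define S where "S = (\<Union>n. stage n)"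
  have "F c \<subseteq> S" if c: "fst ` set c \<subseteq> S" for c
  proof -
    have "\<exists>T\<in>range stage. fst ` set c \<subseteq> T"
    proof (rule finite_subset_Union_chain)
      show "fst ` set c \<subseteq> \<Union> (range stage)" using c by (simp add: S_def)
      show "subset.chain UNIV (range stage)"
        unfolding subset_chain_def using mono by (metis UNIV_I image_iff nat_le_linear subsetI)
    qed auto
    then obtain n where "fst ` set c \<subseteq> stage n" by blast
    then have "c \<in> lists (stage n \<times> UNIV)" by force
    then have "F c \<subseteq> stage (Suc n)" by (auto simp: Suc step_def)
    then show ?thesis by (auto simp: S_def)
  qed
  moreover have "countable S" by (simp add: S_def cnt)
  ultimately show thesis by (intro that)
qed

text \<open>
  Heuristically, \<open>g\<close> depends on countably many coordinates, so its restriction to \<open>D \<times> D\<close>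
  lives on a second countable space, whose discrete subsets are countable.  The code \<open>A x\<close> plays
  the role of a basic neighbourhood of the image of \<open>x\<close> there that contains no other point of
  the image of \<open>D\<close>.
\<close>

lemma countable_if_diagonal_separated:
  fixes g :: "('k \<Rightarrow> real) \<times> ('k \<Rightarrow> real) \<Rightarrow> real"
  assumes g: "continuous_map (prod_topology (powertop_real K) (powertop_real K)) euclideanreal g"
    and D: "D \<subseteq> (\<Pi>\<^sub>E k\<in>K. UNIV)"
    and diag: "\<And>x. x \<in> D \<Longrightarrow> g (x, x) > 1/2"
    and off: "\<And>x y. x \<in> D \<Longrightarrow> y \<in> D \<Longrightarrow> x \<noteq> y \<Longrightarrow> g (x, y) < 1/2"
  shows "countable D"
proof -
  let ?X = "\<Pi>\<^sub>E k\<in>K. (UNIV :: real set)"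
  define L where "L = {p \<in> ?X \<times> ?X. g p < 1/2}"
  define H where "H = {p \<in> ?X \<times> ?X. g p > 1/2}"
  have L: "openin (prod_topology (powertop_real K) (powertop_real K)) L"
    using openin_continuous_map_preimage[OF g, of "{..<1/2}"] by (simp add: L_def)
  have H: "openin (prod_topology (powertop_real K) (powertop_real K)) H"
    using openin_continuous_map_preimage[OF g, of "{1/2<..}"] by (simp add: H_def)

  have refine: "\<exists>a b. (rat_box K c \<times> rat_box K c) \<inter> L \<noteq> {} \<longrightarrow> rat_box K a \<noteq> {} \<and> rat_box K b \<noteq> {}
      \<and> rat_box K a \<subseteq> rat_box K c \<and> rat_box K b \<subseteq> rat_box K c \<and> rat_box K a \<times> rat_box K b \<subseteq> L" for c
  proof (cases "(rat_box K c \<times> rat_box K c) \<inter> L = {}")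
    case False
    then obtain x y where xy: "x \<in> rat_box K c" "y \<in> rat_box K c" "(x, y) \<in> L" by auto
    obtain a b where ab: "x \<in> rat_box K a" "y \<in> rat_box K b" "rat_box K a \<times> rat_box K b \<subseteq> L"
      using rat_box_neighbourhood_prod[OF L xy(3)] .
    show ?thesis
      by (rule exI[of _ "c @ a"], rule exI[of _ "c @ b"]) (use xy ab in \<open>auto simp: rat_box_append\<close>)
  qed simp
  then obtain a b where ab: "\<And>c. (rat_box K c \<times> rat_box K c) \<inter> L \<noteq> {} \<Longrightarrow>
      rat_box K (a c) \<noteq> {} \<and> rat_box K (b c) \<noteq> {}
      \<and> rat_box K (a c) \<subseteq> rat_box K c \<and> rat_box K (b c) \<subseteq> rat_box K c \<and> rat_box K (a c) \<times> rat_box K (b c) \<subseteq> L"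
    by metis
  obtain S where cntS: "countable S"
    and S: "\<And>c. fst ` set c \<subseteq> S \<Longrightarrow> fst ` set (a c) \<union> fst ` set (b c) \<subseteq> S"
    using countable_closing_off[of "\<lambda>c. fst ` set (a c) \<union> fst ` set (b c)"]
    by (metis countable_finite finite_Un finite_imageI finite_set)

  have "\<exists>c. x \<in> rat_box K c \<and> rat_box K c \<times> rat_box K c \<subseteq> H" if "x \<in> D" for x
  proof -
    have "(x, x) \<in> H" using that D diag by (auto simp: H_def)
    then obtain c d where "x \<in> rat_box K c" "x \<in> rat_box K d" "rat_box K c \<times> rat_box K d \<subseteq> H"
      using rat_box_neighbourhood_prod[OF H] by metis
    then show ?thesis
      by (intro exI[of _ "c @ d"]) (auto simp: rat_box_append)
  qed
  then obtain W where W: "\<And>x. x \<in> D \<Longrightarrow> x \<in> rat_box K (W x)"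
      "\<And>x. x \<in> D \<Longrightarrow> rat_box K (W x) \<times> rat_box K (W x) \<subseteq> H"
    by metis
  define A where "A x = filter (\<lambda>t. fst t \<in> S) (W x)" for x

  have "inj_on A D"
  proof (rule inj_onI, rule ccontr)
    fix x y assume x: "x \<in> D" and y: "y \<in> D" and eq: "A x = A y" and ne: "x \<noteq> y"
    have "rat_box K (W u) \<subseteq> rat_box K (A u)" for u
      by (rule rat_box_antimono) (auto simp: A_def)
    then have "x \<in> rat_box K (A x)" "y \<in> rat_box K (A x)"
      using W(1)[OF x] W(1)[OF y] eq by (metis subsetD)+
    moreover have "(x, y) \<in> L"
      using x y ne off D by (auto simp: L_def)
    ultimately have "(rat_box K (A x) \<times> rat_box K (A x)) \<inter> L \<noteq> {}" by blast
    note ab = ab[OF this]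
    then obtain z w where z: "z \<in> rat_box K (a (A x))" and w: "w \<in> rat_box K (b (A x))" by blast
    have supp: "fst ` set (a (A x)) \<subseteq> S" "fst ` set (b (A x)) \<subseteq> S"
      using S[of "A x"] by (auto simp: A_def)
    \<comment> \<open>Changing \<open>u\<close> outside \<open>S\<close> to \<open>x\<close> is invisible to boxes over \<open>S\<close>, and restores the
      constraints of \<open>W x\<close> that were dropped in \<open>A x\<close>.\<close>
    define m where "m u k = (if k \<in> S then u k else x k)" for u :: "'k \<Rightarrow> real" and k
    have m_ext: "m u \<in> ?X" if "u \<in> ?X" for u
      using that x D by (auto simp: m_def PiE_iff extensional_def)
    have m_keep: "m u \<in> rat_box K c" if u: "u \<in> rat_box K c" and c: "fst ` set c \<subseteq> S" for u c
    proof (rule in_rat_boxI)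
      show "m u \<in> ?X" using m_ext in_rat_box_PiE[OF u] .
      fix k q r assume t: "(k, q, r) \<in> set c"
      then have "k \<in> S" using c by force
      then show "of_rat q < m u k \<and> m u k < of_rat r"
        using in_rat_boxD[OF u t] by (simp add: m_def)
    qed
    have m_W: "m u \<in> rat_box K (W x)" if u: "u \<in> rat_box K (A x)" for u
    proof (rule in_rat_boxI)
      show "m u \<in> ?X" using m_ext in_rat_box_PiE[OF u] .
      fix k q r assume t: "(k, q, r) \<in> set (W x)"
      show "of_rat q < m u k \<and> m u k < of_rat r"
      proof (cases "k \<in> S")
        case True
        with t have "(k, q, r) \<in> set (A x)" by (simp add: A_def)
        with True show ?thesis using in_rat_boxD[OF u] by (simp add: m_def)
      next
        case False
        then show ?thesis using in_rat_boxD[OF W(1)[OF x] t] by (simp add: m_def)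
      qed
    qed
    have "(m z, m w) \<in> L"
      using m_keep[OF z supp(1)] m_keep[OF w supp(2)] ab by blast
    moreover have "z \<in> rat_box K (A x)" "w \<in> rat_box K (A x)"
      using z w ab by auto
    then have "(m z, m w) \<in> H"
      using m_W W(2)[OF x] by (meson SigmaI subsetD)
    ultimately show False by (simp add: L_def H_def)
  qed
  moreover have "countable (A ` D)"
  proof (rule countable_subset)
    show "A ` D \<subseteq> lists (S \<times> UNIV)"
      by (auto simp: A_def)
    show "countable (lists (S \<times> (UNIV :: (rat \<times> rat) set)))"
      by (intro countable_lists countable_SIGMA cntS) simp
  qed
  ultimately show ?thesis
    by (rule countable_image_inj_on[rotated])
qed

theorem mainTheorem6:
  fixes K :: "'k set" and D :: "('k \<Rightarrow> real) set"
  assumes "closedin (powertop_real K) D"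
    and "subtopology (powertop_real K) D = discrete_topology D"
    and "uncountable D"
    and "C_embedded_in (powertop_real K) D"
  shows "\<not> C_star_embedded_in (prod_topology (powertop_real K) (powertop_real K)) (D \<times> D)"
proof
  assume ext: "C_star_embedded_in (prod_topology (powertop_real K) (powertop_real K)) (D \<times> D)"
  define f :: "('k \<Rightarrow> real) \<times> ('k \<Rightarrow> real) \<Rightarrow> real" where
    "f p = (if fst p = snd p then 1 else 0)" for p
  have "subtopology (prod_topology (powertop_real K) (powertop_real K)) (D \<times> D)
      = discrete_topology (D \<times> D)"
    by (simp add: subtopology_Times assms(2) prod_topology_discrete_topology)
  then have "continuous_map (subtopology (prod_topology (powertop_real K) (powertop_real K)) (D \<times> D))
      euclideanreal f"
    by simp
  moreover have "bounded (f ` (D \<times> D))"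
    by (rule bounded_subset[of "{0, 1}"]) (auto simp: f_def)
  ultimately obtain g
    where g: "continuous_map (prod_topology (powertop_real K) (powertop_real K)) euclideanreal g"
      and gf: "\<And>p. p \<in> D \<times> D \<Longrightarrow> g p = f p"
    using ext unfolding C_star_embedded_in_def by metis
  have "D \<subseteq> (\<Pi>\<^sub>E k\<in>K. UNIV)"
    using closedin_subset[OF assms(1)] by simp
  from g this have "countable D"
    by (rule countable_if_diagonal_separated) (auto simp: gf f_def)
  with assms(3) show False by simp
qed

end
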